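(* Let $(\mathfrak g,\cdot_{\mathfrak g})$ be a pre-Lie algebra and $N$ a para-complex structure on it. Set $\mathfrak g^+=\{x\in\mathfrak g\mid N(x)=x\}$ and $\mathfrak g^-=\{x\in\mathfrak g\mid N(x)=-x\}$. Then both $\mathfrak g^+$ and $\mathfrak g^-$ are pre-Lie subalgebras of $(\mathfrak g,\cdot_{\mathfrak g})$.
   Context: $\mathbb K$ is an algebraically closed field of characteristic $0$; vector spaces are finite dimensional over $\mathbb K$. A pre-Lie algebra is a vector space $\mathfrak g$ with a bilinear product $\cdot_{\mathfrak g}$ such that $(x\cdot_{\mathfrak g} y)\cdot_{\mathfrak g} z-x\cdot_{\mathfrak g}(y\cdot_{\mathfrak g} z)$ is symmetric in $x,y$. A linear map $N:\mathfrak g\to\mathfrak g$ is a Nijenhuis operator if $N(x)\cdot_{\mathfrak g}N(y)=N\big(N(x)\cdot_{\mathfrak g}y+x\cdot_{\mathfrak g}N(y)-N(x\cdot_{\mathfrak g}y)\big)$ for all $x,y$. A para-complex structure on $(\mathfrak g,\cdot_{\mathfrak g})$ is a Nijenhuis operator $N$ with $N^2=\mathrm{Id}$ and $\dim\ker(N+\mathrm{Id})=\dim\ker(N-\mathrm{Id})$. *)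

theory Defs
  imports Complex_Main "HOL-Computational_Algebra.Polynomial"
begin

text \<open>
  The symmetry axiom is \<open>(x, y, z) = (y, x, z)\<close> for the associator, i.e. the algebras are
  left-symmetric. Finite dimensionality is not part of this locale.
\<close>

locale pre_lie_algebra = vector_space scale
  for scale :: "'k::field \<Rightarrow> 'g::ab_group_add \<Rightarrow> 'g" (infixr "*s" 75) +
  fixes mult :: "'g \<Rightarrow> 'g \<Rightarrow> 'g" (infixl "\<cdot>" 70)
  assumes linear_mult_right: "Vector_Spaces.linear scale scale (\<lambda>y. x \<cdot> y)"
    and linear_mult_left: "Vector_Spaces.linear scale scale (\<lambda>x. x \<cdot> y)"
    and left_symmetric:
      "(x \<cdot> y) \<cdot> z - x \<cdot> (y \<cdot> z) = (y \<cdot> x) \<cdot> z - y \<cdot> (x \<cdot> z)"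
begin

definition nijenhuis_operator :: "('g \<Rightarrow> 'g) \<Rightarrow> bool" where
  "nijenhuis_operator N \<longleftrightarrow>
     Vector_Spaces.linear scale scale N \<and>
     (\<forall>x y. N x \<cdot> N y = N (N x \<cdot> y + x \<cdot> N y - N (x \<cdot> y)))"

definition para_complex_structure :: "('g \<Rightarrow> 'g) \<Rightarrow> bool" where
  "para_complex_structure N \<longleftrightarrow>
     nijenhuis_operator N \<and>
     N \<circ> N = id \<and>
     dim {x. N x + x = 0} = dim {x. N x - x = 0}"

text \<open>
  The pre-Lie identity on a subalgebra is inherited from the ambient algebra.
\<close>

definition pre_lie_subalgebra :: "'g set \<Rightarrow> bool" where
  "pre_lie_subalgebra H \<longleftrightarrow> subspace H \<and> (\<forall>x\<in>H. \<forall>y\<in>H. x \<cdot> y \<in> H)"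

end

end

theory Submission
  imports Defs
begin

text \<open>
  Evaluate the Nijenhuis identity on two eigenvectors \<open>x\<close>, \<open>y\<close> of \<open>N\<close> with the same eigenvalue
  \<open>c\<close>: every \<open>N\<close> applied directly to \<open>x\<close> or \<open>y\<close> becomes the scalar \<open>c\<close>, and what remains says that
  \<open>(N - c)\<^sup>2\<close> kills \<open>x \<cdot> y\<close>. So \<open>x \<cdot> y\<close> lies in the generalized eigenspace of \<open>c\<close>. If in
  addition \<open>N\<^sup>2 = c\<^sup>2\<close> with \<open>2c \<noteq> 0\<close>, then \<open>N\<close> is diagonalizable with eigenvalues among \<open>\<plusminus>c\<close>, so the
  generalized eigenspace is the eigenspace itself. A para-complex structure satisfies this for
  \<open>c = 1\<close> and \<open>c = -1\<close>, since \<open>2 \<noteq> 0\<close> in characteristic \<open>0\<close>.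
\<close>

context pre_lie_algebra
begin

lemma mult_scale_left: "(a *s x) \<cdot> y = a *s (x \<cdot> y)"
  using linear_mult_left[of y] by (simp add: Vector_Spaces.linear_iff)

lemma mult_scale_right: "x \<cdot> (a *s y) = a *s (x \<cdot> y)"
  using linear_mult_right[of x] by (simp add: Vector_Spaces.linear_iff)

lemma subspace_eigenspace:
  assumes "Vector_Spaces.linear scale scale N"
  shows "subspace {x. N x = c *s x}"
proof -
  interpret N: Vector_Spaces.linear scale scale N by (fact assms)
  show ?thesis
    by (rule subspaceI) (simp_all add: N.zero N.add N.scale scale_right_distrib mult.commute)
qed

text \<open>
  The conclusion is \<open>(N - c)\<^sup>2 (x \<cdot> y) = 0\<close>, expanded so that no operator arithmetic is needed.
\<close>

lemma nijenhuis_eigenvectors_mult: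
  assumes nij: "nijenhuis_operator N"
    and x: "N x = c *s x" and y: "N y = c *s y"
  shows "N (N (x \<cdot> y)) - (2 * c) *s N (x \<cdot> y) + (c * c) *s (x \<cdot> y) = 0"
proof -
  interpret N: Vector_Spaces.linear scale scale N
    using nij by (simp add: nijenhuis_operator_def)
  have "(c * c) *s (x \<cdot> y) = N x \<cdot> N y"
    by (simp add: x y mult_scale_left mult_scale_right)
  also have "\<dots> = N (N x \<cdot> y + x \<cdot> N y - N (x \<cdot> y))"
    using nij by (simp add: nijenhuis_operator_def)
  also have "\<dots> = (2 * c) *s N (x \<cdot> y) - N (N (x \<cdot> y))"
    by (simp add: x y mult_scale_left mult_scale_right N.add N.diff N.scale
        flip: scale_left_distrib)
  finally show ?thesis by simp
qed

text \<open>
  Substituting \<open>N\<^sup>2 = c\<^sup>2\<close> into \<open>(N - c)\<^sup>2\<close> gives \<open>-2c (N - c)\<close>, and the scalar can be cancelled.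
\<close>

lemma pre_lie_subalgebra_eigenspace:
  assumes nij: "nijenhuis_operator N"
    and square: "\<And>x. N (N x) = (c * c) *s x"
    and nz: "2 * c \<noteq> 0"
  shows "pre_lie_subalgebra {x. N x = c *s x}"
proof -
  have "N (x \<cdot> y) = c *s (x \<cdot> y)" if "N x = c *s x" and "N y = c *s y" for x y
  proof -
    have double: "(2 * (c * c)) *s z = (c * c) *s z + (c * c) *s z" for z
      by (simp flip: scale_left_distrib)
    have "(2 * c) *s (N (x \<cdot> y) - c *s (x \<cdot> y)) =
        - (N (N (x \<cdot> y)) - (2 * c) *s N (x \<cdot> y) + (c * c) *s (x \<cdot> y))"
      by (simp add: square scale_right_diff_distrib double mult.assoc)
    also have "\<dots> = 0"
      using nijenhuis_eigenvectors_mult[OF nij that] by simp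
    finally show ?thesis
      using nz by simp
  qed
  then show ?thesis
    using nij by (simp add: pre_lie_subalgebra_def nijenhuis_operator_def subspace_eigenspace)
qed

end

theorem proposition7p2:
  fixes scale :: "'k::{alg_closed_field, field_char_0} \<Rightarrow> 'g::ab_group_add \<Rightarrow> 'g"
    and Basis :: "'g set"
    and mult :: "'g \<Rightarrow> 'g \<Rightarrow> 'g"
    and N :: "'g \<Rightarrow> 'g"
  assumes "finite_dimensional_vector_space scale Basis"
    and "pre_lie_algebra scale mult"
    and "pre_lie_algebra.para_complex_structure scale mult N"
  shows "pre_lie_algebra.pre_lie_subalgebra scale mult {x. N x = x} \<and>
         pre_lie_algebra.pre_lie_subalgebra scale mult {x. N x = - x}"
proof -
  interpret pre_lie_algebra scale mult by (fact assms(2))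
  have nij: "nijenhuis_operator N" and invol: "N (N x) = x" for x
    using assms(3) by (simp_all add: para_complex_structure_def fun_eq_iff)
  have "pre_lie_subalgebra {x. N x = scale 1 x}"
    by (rule pre_lie_subalgebra_eigenspace) (simp_all add: nij invol)
  moreover have "pre_lie_subalgebra {x. N x = scale (- 1) x}"
    by (rule pre_lie_subalgebra_eigenspace) (simp_all add: nij invol)
  ultimately show ?thesis
    by simp
qed

end
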